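(* Let $\mathcal{H}$ be a real Hilbert space, let $K$ be a nonempty closed convex cone in $\mathcal{H}$, let $\rho>0$, and set $C := K\cap B(0;\rho)$. Then for every $x\in\mathcal{H}$, $$P_C x=\frac{\rho}{\max\{\|P_Kx\|,\rho\}}\,P_Kx\qquad\text{and}\qquad d_C(x)=\sqrt{d_K^2(x)+\bigl(\max\{\|P_Kx\|-\rho,0\}\bigr)^2}.$$
   Context: A subset $K$ of $\mathcal{H}$ is a cone if $K=\bigcup_{\lambda>0}\lambda K$. $B(0;\rho)=\{y\in\mathcal{H} : \|y\|\le\rho\}$. For a nonempty subset $C$ of $\mathcal{H}$, $d_C(x)=\inf_{y\in C}\|x-y\|$ is the distance function; for a nonempty closed convex set $C$, $P_Cx$ denotes the unique point $u$ of $C$ with $\|x-u\|=d_C(x)$. *)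

theory Defs
  imports "HOL-Analysis.Analysis"
begin

text \<open>
  A cone is only required to be invariant under strictly positive scalings, so \<^const>\<open>cone\<close>,
  which also scales by zero, is not the same notion.
\<close>

definition pos_cone :: "'a::real_vector set \<Rightarrow> bool"
  where "pos_cone K \<longleftrightarrow> K = (\<Union>c\<in>{0<..}. (*\<^sub>R) c ` K)"

text \<open>
  The projection onto a nonempty closed convex set. The library's \<^const>\<open>closest_point\<close> is
  restricted to Heine-Borel spaces, that is, to finite dimension. The distance function is
  \<^const>\<open>infdist\<close>, with the point as first argument.
\<close>

definition metric_proj :: "'a::{real_inner,complete_space} set \<Rightarrow> 'a \<Rightarrow> 'a"
  where "metric_proj C x = (THE u. u \<in> C \<and> norm (x - u) = infdist x C)"

end

theory Submission
  imports Defs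
begin

text \<open>
  The projection onto a nonempty closed convex set is characterised by an obtuse angle: \<open>u\<close> is the
  projection of \<open>x\<close> iff \<open>u\<close> lies in the set and \<open>(x - u) \<bullet> (y - u) \<le> 0\<close> for all its points \<open>y\<close>.

  On a cone one may take for \<open>y\<close> both a longer and a shorter multiple of the projection \<open>p\<close> of \<open>x\<close>.
  Hence \<open>x - p\<close> is orthogonal to \<open>p\<close>, and then \<open>(x - p) \<bullet> y \<le> 0\<close> for all \<open>y\<close> in the cone.
  Let \<open>u = c p\<close> be the radial truncation of \<open>p\<close> to the ball. In the splitting
  \<open>x - u = (x - p) + (1 - c) p\<close> the first summand makes an obtuse angle with \<open>y - u\<close> because \<open>u\<close> is
  a multiple of \<open>p\<close>, and the second does because \<open>u\<close> is the projection of \<open>p\<close> onto the ball.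
  So \<open>u\<close> is the projection of \<open>x\<close> onto the truncated cone. The two summands are orthogonal, and
  Pythagoras gives the formula for the distance.
\<close>

section \<open>Projections in Hilbert spaces\<close>

lemma infdist_square_almost_attained:
  fixes x :: "'a::real_normed_vector"
  assumes "C \<noteq> {}" and "e > 0"
  obtains y where "y \<in> C" and "(norm (x - y))\<^sup>2 < (infdist x C)\<^sup>2 + e"
proof -
  have "infdist x C = sqrt ((infdist x C)\<^sup>2)"
    by (simp add: infdist_nonneg)
  also have "\<dots> < sqrt ((infdist x C)\<^sup>2 + e)"
    using \<open>e > 0\<close> by (intro real_sqrt_less_mono) simp
  finally have "(INF y\<in>C. dist x y) < sqrt ((infdist x C)\<^sup>2 + e)"
    using \<open>C \<noteq> {}\<close> by (simp add: infdist_notempty)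
  then obtain y where "y \<in> C" and less: "dist x y < sqrt ((infdist x C)\<^sup>2 + e)"
    using cInf_lessD[of "dist x ` C"] \<open>C \<noteq> {}\<close> by auto
  have "(norm (x - y))\<^sup>2 < (sqrt ((infdist x C)\<^sup>2 + e))\<^sup>2"
    using less by (intro power_strict_mono) (auto simp: dist_norm)
  also have "\<dots> = (infdist x C)\<^sup>2 + e"
    using \<open>e > 0\<close> by simp
  finally show thesis
    using \<open>y \<in> C\<close> that by blast
qed

text \<open>
  The midpoint of two points of a convex set is no closer to \<open>x\<close> than the distance of the set, so by
  the parallelogram law two points that nearly attain the distance are near to each other.
\<close>

lemma convex_near_minimizers_close:
  fixes x y z :: "'a::real_inner"
  assumes "convex C" and "y \<in> C" and "z \<in> C"
    and "(norm (x - y))\<^sup>2 \<le> (infdist x C)\<^sup>2 + a"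
    and "(norm (x - z))\<^sup>2 \<le> (infdist x C)\<^sup>2 + b"
  shows "(norm (y - z))\<^sup>2 \<le> 2 * a + 2 * b"
proof -
  define m where "m = (1/2) *\<^sub>R y + (1/2) *\<^sub>R z"
  have "m \<in> C"
    using assms(1-3) unfolding m_def by (intro convexD) auto
  then have "infdist x C \<le> norm (x - m)"
    by (metis dist_norm infdist_le)
  then have "(infdist x C)\<^sup>2 \<le> (norm (x - m))\<^sup>2"
    by (intro power_mono infdist_nonneg)
  moreover have "(norm (y - z))\<^sup>2
      = 2 * (norm (x - y))\<^sup>2 + 2 * (norm (x - z))\<^sup>2 - 4 * (norm (x - m))\<^sup>2"
    unfolding m_def power2_norm_eq_inner
    by (simp add: inner_diff_left inner_diff_right inner_add_left inner_add_right
        inner_commute algebra_simps)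
  ultimately show ?thesis
    using assms(4,5) by linarith
qed

text \<open>Completeness turns a minimizing sequence, which is Cauchy, into a minimizer.\<close>

lemma closed_convex_infdist_attained:
  fixes x :: "'a::{real_inner,complete_space}"
  assumes "C \<noteq> {}" and "closed C" and "convex C"
  obtains u where "u \<in> C" and "norm (x - u) = infdist x C"
proof -
  have "\<exists>y. y \<in> C \<and> (norm (x - y))\<^sup>2 < (infdist x C)\<^sup>2 + inverse (real (Suc n))" for n
    by (rule infdist_square_almost_attained[OF \<open>C \<noteq> {}\<close>, of "inverse (real (Suc n))" x]) auto
  then obtain y where y_in: "\<And>n. y n \<in> C"
    and y_near: "\<And>n. (norm (x - y n))\<^sup>2 < (infdist x C)\<^sup>2 + inverse (real (Suc n))"
    by metis
  have "Cauchy y"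
  proof (rule metric_CauchyI)
    fix e :: real
    assume "e > 0"
    then obtain N where N: "inverse (real (Suc N)) < e\<^sup>2 / 4"
      using reals_Archimedean[of "e\<^sup>2 / 4"] by auto
    have tail: "(norm (x - y n))\<^sup>2 \<le> (infdist x C)\<^sup>2 + inverse (real (Suc N))" if "n \<ge> N" for n
    proof -
      have "inverse (real (Suc n)) \<le> inverse (real (Suc N))"
        using that by (intro le_imp_inverse_le) auto
      then show ?thesis
        using y_near[of n] by linarith
    qed
    have "dist (y m) (y n) < e" if "m \<ge> N" "n \<ge> N" for m n
    proof -
      have "(norm (y m - y n))\<^sup>2 < e\<^sup>2"
        using convex_near_minimizers_close[OF \<open>convex C\<close> y_in y_in tail tail] that N by fastforce
      then show ?thesis
        using \<open>e > 0\<close> by (simp add: dist_norm power_less_imp_less_base)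
    qed
    then show "\<exists>M. \<forall>m\<ge>M. \<forall>n\<ge>M. dist (y m) (y n) < e"
      by blast
  qed
  then obtain u where lim: "y \<longlonglongrightarrow> u"
    using Cauchy_convergent convergent_def by blast
  have "u \<in> C"
    using \<open>closed C\<close> y_in lim by (metis closed_sequentially)
  have "(\<lambda>n. (norm (x - y n))\<^sup>2) \<longlonglongrightarrow> (norm (x - u))\<^sup>2"
    by (intro tendsto_intros lim)
  moreover have "(\<lambda>n. (infdist x C)\<^sup>2 + inverse (real (Suc n))) \<longlonglongrightarrow> (infdist x C)\<^sup>2 + 0"
    by (intro tendsto_intros LIMSEQ_inverse_real_of_nat)
  ultimately have "(norm (x - u))\<^sup>2 \<le> (infdist x C)\<^sup>2 + 0"
    by (rule LIMSEQ_le) (use y_near less_imp_le in blast)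
  then have "norm (x - u) \<le> infdist x C"
    by (auto intro: power2_le_imp_le simp: infdist_nonneg)
  moreover have "infdist x C \<le> norm (x - u)"
    using \<open>u \<in> C\<close> by (metis dist_norm infdist_le)
  ultimately show thesis
    using \<open>u \<in> C\<close> that by force
qed

text \<open>
  An obtuse angle at \<open>u\<close> gives \<open>\<parallel>x - y\<parallel>\<^sup>2 \<ge> \<parallel>x - u\<parallel>\<^sup>2 + \<parallel>u - y\<parallel>\<^sup>2\<close>, so \<open>u\<close> is a minimizer, and the
  last summand makes it the only one.
\<close>

lemma metric_proj_eqI:
  fixes x u :: "'a::{real_inner,complete_space}"
  assumes "u \<in> C" and obtuse: "\<And>y. y \<in> C \<Longrightarrow> (x - u) \<bullet> (y - u) \<le> 0"
  shows "metric_proj C x = u" and "infdist x C = norm (x - u)"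
proof -
  have gap: "(norm (x - u))\<^sup>2 + (norm (u - y))\<^sup>2 \<le> (norm (x - y))\<^sup>2" if "y \<in> C" for y
    using obtuse[OF that] dot_norm_neg[of "x - u" "y - u"] by (simp add: norm_minus_commute)
  have "norm (x - u) \<le> dist x y" if "y \<in> C" for y
    unfolding dist_norm
  proof (rule power2_le_imp_le)
    show "(norm (x - u))\<^sup>2 \<le> (norm (x - y))\<^sup>2"
      using gap[OF that] zero_le_power2[of "norm (u - y)"] by linarith
  qed simp
  then have "norm (x - u) \<le> infdist x C"
    using \<open>u \<in> C\<close> by (auto simp: infdist_def intro: cINF_greatest)
  moreover have "infdist x C \<le> norm (x - u)"
    using \<open>u \<in> C\<close> by (metis dist_norm infdist_le)
  ultimately show dist: "infdist x C = norm (x - u)"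
    by simp
  show "metric_proj C x = u"
    unfolding metric_proj_def
  proof (rule the_equality)
    show "u \<in> C \<and> norm (x - u) = infdist x C"
      using \<open>u \<in> C\<close> dist by simp
  next
    fix v
    assume "v \<in> C \<and> norm (x - v) = infdist x C"
    then have "v \<in> C" and "norm (x - v) = norm (x - u)"
      unfolding dist by blast+
    then have "(norm (u - v))\<^sup>2 \<le> 0"
      using gap[of v] by simp
    then show "v = u"
      by simp
  qed
qed

text \<open>
  Moving from the minimizer \<open>u\<close> a fraction \<open>t\<close> of the way to \<open>y\<close> changes the squared distance by
  \<open>t\<^sup>2 \<parallel>y - u\<parallel>\<^sup>2 - 2 t (x - u) \<bullet> (y - u)\<close>. A positive inner product would make this negative
  for small \<open>t\<close>.
\<close>

lemma convex_minimizer_obtuse: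
  fixes x u :: "'a::real_inner"
  assumes "convex C" and "u \<in> C" and min: "norm (x - u) = infdist x C" and "y \<in> C"
  shows "(x - u) \<bullet> (y - u) \<le> 0"
proof -
  define s where "s = (x - u) \<bullet> (y - u)"
  define q where "q = (norm (y - u))\<^sup>2"
  have linear: "2 * s \<le> t * q" if "0 < t" "t \<le> 1" for t
  proof -
    have "(1 - t) *\<^sub>R u + t *\<^sub>R y \<in> C"
      using assms(1,2,4) that by (intro convexD) auto
    then have "infdist x C \<le> norm (x - ((1 - t) *\<^sub>R u + t *\<^sub>R y))"
      by (metis dist_norm infdist_le)
    also have "x - ((1 - t) *\<^sub>R u + t *\<^sub>R y) = (x - u) - t *\<^sub>R (y - u)"
      by (simp add: algebra_simps)
    finally have "(norm (x - u))\<^sup>2 \<le> (norm ((x - u) - t *\<^sub>R (y - u)))\<^sup>2"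
      unfolding min by (intro power_mono infdist_nonneg)
    also have "\<dots> = (norm (x - u))\<^sup>2 - t * (2 * s) + t * (t * q)"
      using dot_norm_neg[of "x - u" "t *\<^sub>R (y - u)"]
      by (simp add: s_def q_def power_mult_distrib power2_eq_square[of t])
    finally have "t * (2 * s) \<le> t * (t * q)"
      by linarith
    then show ?thesis
      using \<open>0 < t\<close> by simp
  qed
  have "((\<lambda>t. t * q) \<longlongrightarrow> 0 * q) (at_right 0)"
    by (intro tendsto_intros)
  moreover have "\<forall>\<^sub>F t in at_right 0. 2 * s \<le> t * q"
    using linear unfolding eventually_at_right_field by (metis zero_less_one less_imp_le)
  ultimately have "2 * s \<le> 0 * q"
    using tendsto_lowerbound by (metis trivial_limit_at_right_real)
  then show ?thesis
    by (simp add: s_def)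
qed

section \<open>Cones and their truncations\<close>

lemma pos_cone_scaleR:
  assumes "pos_cone K" and "y \<in> K" and "c > 0"
  shows "c *\<^sub>R y \<in> K"
  using assms unfolding pos_cone_def by blast

text \<open>
  Comparing the minimizer \<open>p\<close> with \<open>2 p\<close> and with \<open>p / 2\<close> gives the two signs of
  \<open>(x - p) \<bullet> p\<close>; this also covers a cone that is given without its apex.
\<close>

lemma cone_minimizer_orthogonal:
  fixes x p :: "'a::real_inner"
  assumes "convex K" and "pos_cone K" and "p \<in> K" and "norm (x - p) = infdist x K"
  shows "(x - p) \<bullet> p = 0" and "y \<in> K \<Longrightarrow> (x - p) \<bullet> y \<le> 0"
proof -
  note obtuse = convex_minimizer_obtuse[OF assms(1,3,4)]
  have "(x - p) \<bullet> (2 *\<^sub>R p - p) \<le> 0" and "(x - p) \<bullet> ((1/2) *\<^sub>R p - p) \<le> 0"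
    by (intro obtuse pos_cone_scaleR assms(2,3); simp)+
  then show orth: "(x - p) \<bullet> p = 0"
    unfolding inner_diff_right inner_scaleR_right by linarith
  show "(x - p) \<bullet> y \<le> 0" if "y \<in> K"
    using obtuse[OF that] orth by (simp add: inner_diff_right)
qed

theorem theorem7p1:
  fixes K C :: "'a::{real_inner,complete_space} set" and \<rho> :: real and x :: 'a
  assumes "K \<noteq> {}" and "closed K" and "convex K" and "pos_cone K"
    and "\<rho> > 0"
    and "C = K \<inter> cball 0 \<rho>"
  shows "metric_proj C x =
           (\<rho> / max (norm (metric_proj K x)) \<rho>) *\<^sub>R metric_proj K x
         \<and> infdist x C =
           sqrt ((infdist x K)\<^sup>2 + (max (norm (metric_proj K x) - \<rho>) 0)\<^sup>2)"
proof -
  obtain p where "p \<in> K" and min: "norm (x - p) = infdist x K"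
    using closed_convex_infdist_attained assms(1-3) by blast
  have proj_K: "metric_proj K x = p"
    using metric_proj_eqI(1)[OF \<open>p \<in> K\<close>]
      convex_minimizer_obtuse[OF \<open>convex K\<close> \<open>p \<in> K\<close> min] by blast
  note cone = cone_minimizer_orthogonal[OF \<open>convex K\<close> \<open>pos_cone K\<close> \<open>p \<in> K\<close> min]
  define c where "c = \<rho> / max (norm p) \<rho>"
  define u where "u = c *\<^sub>R p"
  have "c > 0"
    using \<open>\<rho> > 0\<close> by (simp add: c_def less_max_iff_disj)
  have excess: "(1 - c) * norm p = max (norm p - \<rho>) 0"
    using \<open>\<rho> > 0\<close> by (auto simp: c_def max_def field_simps)
  have "norm u \<le> \<rho>"
    using \<open>\<rho> > 0\<close> by (auto simp: u_def c_def max_def)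
  then have "u \<in> C"
    using \<open>p \<in> K\<close> \<open>c > 0\<close> assms(4,6) by (simp add: u_def pos_cone_scaleR)
  have split: "x - u = (x - p) + (1 - c) *\<^sub>R p"
    by (simp add: u_def algebra_simps)
  have obtuse: "(x - u) \<bullet> (y - u) \<le> 0" if "y \<in> C" for y
  proof -
    have "y \<in> K" and "norm y \<le> \<rho>"
      using that assms(6) by auto
    have "(x - p) \<bullet> (y - u) \<le> 0"
      using cone(1) cone(2)[OF \<open>y \<in> K\<close>] by (simp add: u_def inner_diff_right)
    moreover have "(1 - c) * (p \<bullet> (y - u)) \<le> 0"
    proof (cases "norm p \<le> \<rho>")
      case True
      then show ?thesis
        using \<open>\<rho> > 0\<close> by (simp add: c_def max_def)
    next
      case False
      \<comment> \<open>Here \<open>u\<close> lies on the sphere in the direction of \<open>p\<close>, where \<open>p \<bullet> _\<close> is maximal on the ball.\<close>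
      have "p \<bullet> u = \<rho> * norm p"
        using False \<open>\<rho> > 0\<close>
        by (simp add: u_def c_def max_def dot_square_norm power2_eq_square)
      moreover have "p \<bullet> y \<le> norm p * \<rho>"
        using norm_cauchy_schwarz[of p y] \<open>norm y \<le> \<rho>\<close>
        by (meson mult_left_mono norm_ge_zero order_trans)
      moreover have "1 - c \<ge> 0"
        using False \<open>\<rho> > 0\<close> by (simp add: c_def max_def divide_le_eq_1)
      ultimately show ?thesis
        by (simp add: inner_diff_right mult_nonneg_nonpos mult.commute)
    qed
    ultimately show ?thesis
      unfolding split inner_add_left inner_scaleR_left by linarith
  qed
  have "(norm (x - u))\<^sup>2 = (norm (x - p))\<^sup>2 + (norm ((1 - c) *\<^sub>R p))\<^sup>2"
    unfolding split by (rule norm_add_Pythagorean) (simp add: orthogonal_def cone(1))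
  also have "(norm ((1 - c) *\<^sub>R p))\<^sup>2 = ((1 - c) * norm p)\<^sup>2"
    by (simp add: power_mult_distrib)
  finally have "(norm (x - u))\<^sup>2 = (infdist x K)\<^sup>2 + (max (norm p - \<rho>) 0)\<^sup>2"
    unfolding excess min .
  then have "norm (x - u) = sqrt ((infdist x K)\<^sup>2 + (max (norm p - \<rho>) 0)\<^sup>2)"
    by (metis norm_ge_zero real_sqrt_abs abs_of_nonneg)
  then show ?thesis
    using metric_proj_eqI[OF \<open>u \<in> C\<close> obtuse] unfolding proj_K u_def c_def by simp
qed

end
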